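(* The (edge-based) VCG mechanism for the driver markets, [VCG/Driver] (defined in the context), is truthful and efficient. That is: (truthful) for every driver $a\in\mathcal A_{(t,w)}$, every bid $\tilde{\mathbf c}_a\in\mathbb R^{\mathcal E}$ and every profile $\tilde{\mathbf c}_{-a}$ of bids of the other drivers, $$u_a(\mathbf c_a,\tilde{\mathbf c}_{-a})\ge u_a(\tilde{\mathbf c}_a,\tilde{\mathbf c}_{-a}),$$ where $\mathbf c_a=(c^a_{ij})_{ij\in\mathcal E}$ is the true perceived edge cost vector of $a$; (efficient) when all drivers bid truthfully ($\tilde{\mathbf c}_a=\mathbf c_a$ for all $a\in\mathcal A_{(t,w)}$), the resulting matching is socially optimal, i.e. minimizes $\sum_{a\in\mathcal A_{(t,w)}}\sum_{k=0}^K\sum_{ij\in\mathcal E}m^a_{k,ij}c^a_{ij}$ over all feasible matchings.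
   Context: Fix a driver group $\mathcal A_{(t,w)}$ (a finite set of $N^D_{(t,w)}$ drivers traveling in time window $t$ between origin-destination pair $w=(o,d)$), a finite set $\mathcal J$ of task categories, and an integer $K\ge1$ (maximum number of tasks per driver). Let $\tilde{\mathcal J}=\mathcal J\cup\{d\}$. Task-chain network. Its states are $(0,o)$; $(k,j)$ for $k=1,\dots,K$, $j\in\tilde{\mathcal J}$; and $(K+1,d)$. Let $\mathcal E$ be the set of task pairs (edges) consisting of $(o,j)$ with $j\in\tilde{\mathcal J}$, $(i,j)$ with $i\in\mathcal J$, $j\in\tilde{\mathcal J}$, and the dummy edge $(d,d)$; using edge $ij\in\mathcal E$ at stage $k\in\{0,\dots,K\}$ means moving from state $(k,i)$ to state $(k+1,j)$ (both must be states of the network). A path from $(0,o)$ to $(K+1,d)$ thus corresponds to a sequence $[o,j_1,\dots,j_K,d]$ in which once $d$ is reached it is kept; it represents a task bundle (the empty bundle if $j_1=d$). Data. Each driver $a$ has privately known perceived edge costs $c^a_{ij}\in\mathbb R$, $ij\in\mathcal E$, independent of $k$. An allocation of tasks $\mathbf x=(x_{k,ij})$ of nonnegative integers is given, which is a flow of $N^D_{(t,w)}$ units from $(0,o)$ to $(K+1,d)$ on the network. A feasible matching is $\mathbf m=(m^a_{k,ij})$ with $m^a_{k,ij}\in\{0,1\}$ such that for every driver $a$, $(m^a_{k,ij})_{k,ij}$ is a unit flow from $(0,o)$ to $(K+1,d)$, i.e. $\sum_i m^a_{k-1,ij}-\sum_l m^a_{k,jl}=\eta_{k,j}$ at every state $(k,j)$,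 where $\eta_{0,o}=-1$, $\eta_{K+1,d}=1$ and $\eta_{k,j}=0$ otherwise (terms outside the network being zero), and such that $\sum_{a\in\mathcal A_{(t,w)}}m^a_{k,ij}=x_{k,ij}$ for all $k\in\{0,\dots,K\}$ and $ij\in\mathcal E$. Mechanism [VCG/Driver]. (1) Each driver $a$ submits a bid $\tilde{\mathbf c}_a=(\tilde c^a_{ij})_{ij\in\mathcal E}$ of real numbers. (2) The platform chooses a feasible matching $\mathbf m^\star(\tilde{\mathbf c})$ minimizing $\sum_{a\in\mathcal A_{(t,w)}}\sum_{k=0}^K\sum_{ij\in\mathcal E}m^a_{k,ij}\tilde c^a_{ij}$ over feasible matchings (with any fixed selection rule if there are several minimizers). (3) Driver $a$ receives the reward $$p_a(\tilde{\mathbf c}_a,\tilde{\mathbf c}_{-a})=\min_{\mathbf m_{-a}}z^D_{-a}(\mathbf m_{-a}|\tilde{\mathbf c}_{-a},\mathbf x)-\sum_{a'\in\mathcal A_{(t,w)}\setminus\{a\}}\sum_{k=0}^K\sum_{ij\in\mathcal E}m^{a'\star}_{k,ij}(\tilde{\mathbf c})\,\tilde c^{a'}_{ij},$$ where the first term is the minimum social cost without the participation of $a$: $z^D_{-a}(\mathbf m_{-a}|\tilde{\mathbf c}_{-a},\mathbf x)=\sum_{a'\ne a}\sum_{k=0}^K\sum_{ij\in\mathcal E}m^{a'}_{k,ij}\tilde c^{a'}_{ij}$, minimized over binary unit flows $(m^{a'}_{k,ij})$ from $(0,o)$ to $(K+1,d)$, one for each $a'\in\mathcal A_{(t,w)}\setminus\{a\}$,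 with $\sum_{a'\ne a}m^{a'}_{k,ij}\le x_{k,ij}$ for all $k$ and $ij\in\mathcal E$. The utility of driver $a$ is $u_a(\tilde{\mathbf c}_a,\tilde{\mathbf c}_{-a})=p_a(\tilde{\mathbf c}_a,\tilde{\mathbf c}_{-a})-\sum_{k=0}^K\sum_{ij\in\mathcal E}m^{a\star}_{k,ij}(\tilde{\mathbf c}_a,\tilde{\mathbf c}_{-a})\,c^a_{ij}$. The subscript $-a$ denotes all drivers in $\mathcal A_{(t,w)}$ other than $a$. *)

theory Defs
  imports Complex_Main
begin

section \<open>The task-chain network\<close>

text \<open>Nodes visited by a driver: the origin \<open>o\<close>, the task categories and the destination \<open>d\<close>.\<close>

datatype 'j node = Orig | Task 'j | Dest

type_synonym 'j edge = "'j node \<times> 'j node"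

definition extended_tasks :: "'j set \<Rightarrow> 'j node set" where
  "extended_tasks J = insert Dest (Task ` J)"

definition states :: "'j set \<Rightarrow> nat \<Rightarrow> (nat \<times> 'j node) set" where
  "states J K = {(0, Orig)} \<union> {1..K} \<times> extended_tasks J \<union> {(K + 1, Dest)}"

definition edges :: "'j set \<Rightarrow> 'j edge set" where
  "edges J = {Orig} \<times> extended_tasks J \<union> (Task ` J) \<times> extended_tasks J \<union> {(Dest, Dest)}"

text \<open>\<open>f k (i, j)\<close> is the amount moved from state \<open>(k, i)\<close> to state \<open>(k + 1, j)\<close>.\<close>

type_synonym 'j flow = "nat \<Rightarrow> 'j edge \<Rightarrow> nat"

definition in_network :: "'j set \<Rightarrow> nat \<Rightarrow> nat \<Rightarrow> 'j edge \<Rightarrow> bool" where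
  "in_network J K k e \<longleftrightarrow>
     k \<le> K \<and> e \<in> edges J \<and> (k, fst e) \<in> states J K \<and> (k + 1, snd e) \<in> states J K"

text \<open>The case distinction only avoids stage \<open>k - 1\<close> at \<open>k = 0\<close>, where nothing enters.\<close>

definition inflow :: "'j set \<Rightarrow> 'j flow \<Rightarrow> nat \<Rightarrow> 'j node \<Rightarrow> nat" where
  "inflow J f k j = (if k = 0 then 0 else \<Sum>i | (i, j) \<in> edges J. f (k - 1) (i, j))"

definition outflow :: "'j set \<Rightarrow> 'j flow \<Rightarrow> nat \<Rightarrow> 'j node \<Rightarrow> nat" where
  "outflow J f k j = (\<Sum>l | (j, l) \<in> edges J. f k (j, l))"

definition eta :: "nat \<Rightarrow> nat \<Rightarrow> 'j node \<Rightarrow> int" where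
  "eta K k j = (if (k, j) = (0, Orig) then -1 else if (k, j) = (K + 1, Dest) then 1 else 0)"

definition is_flow :: "'j set \<Rightarrow> nat \<Rightarrow> nat \<Rightarrow> 'j flow \<Rightarrow> bool" where
  "is_flow J K N f \<longleftrightarrow>
     (\<forall>k e. \<not> in_network J K k e \<longrightarrow> f k e = 0) \<and>
     (\<forall>(k, j) \<in> states J K. int (inflow J f k j) - int (outflow J f k j) = int N * eta K k j)"

definition binary_unit_flow :: "'j set \<Rightarrow> nat \<Rightarrow> 'j flow \<Rightarrow> bool" where
  "binary_unit_flow J K f \<longleftrightarrow> is_flow J K 1 f \<and> (\<forall>k e. f k e \<in> {0, 1})"


section \<open>Matchings and costs\<close>

text \<open>Only the values of a matching or a bid profile at the drivers in \<open>A\<close> (and, for bids, at the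
  edges of the network) matter.\<close>

type_synonym ('a, 'j) matching = "'a \<Rightarrow> 'j flow"
type_synonym 'j costs = "'j edge \<Rightarrow> real"
type_synonym ('a, 'j) profile = "'a \<Rightarrow> 'j costs"

definition feasible_matching ::
  "'a set \<Rightarrow> 'j set \<Rightarrow> nat \<Rightarrow> 'j flow \<Rightarrow> ('a, 'j) matching \<Rightarrow> bool" where
  "feasible_matching A J K x m \<longleftrightarrow>
     (\<forall>a\<in>A. binary_unit_flow J K (m a)) \<and>
     (\<forall>k\<in>{0..K}. \<forall>e\<in>edges J. (\<Sum>a\<in>A. m a k e) = x k e)"

definition feasible_without ::
  "'a set \<Rightarrow> 'j set \<Rightarrow> nat \<Rightarrow> 'j flow \<Rightarrow> 'a \<Rightarrow> ('a, 'j) matching \<Rightarrow> bool" where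
  "feasible_without A J K x a m \<longleftrightarrow>
     (\<forall>a'\<in>A - {a}. binary_unit_flow J K (m a')) \<and>
     (\<forall>k\<in>{0..K}. \<forall>e\<in>edges J. (\<Sum>a'\<in>A - {a}. m a' k e) \<le> x k e)"

definition driver_cost :: "'j set \<Rightarrow> nat \<Rightarrow> 'j flow \<Rightarrow> 'j costs \<Rightarrow> real" where
  "driver_cost J K f c = (\<Sum>k=0..K. \<Sum>e\<in>edges J. real (f k e) * c e)"

definition social_cost ::
  "'a set \<Rightarrow> 'j set \<Rightarrow> nat \<Rightarrow> ('a, 'j) matching \<Rightarrow> ('a, 'j) profile \<Rightarrow> real" where
  "social_cost A J K m c = (\<Sum>a\<in>A. driver_cost J K (m a) (c a))"

definition optimal_matching ::
  "'a set \<Rightarrow> 'j set \<Rightarrow> nat \<Rightarrow> 'j flow \<Rightarrow> ('a, 'j) profile \<Rightarrow> ('a, 'j) matching \<Rightarrow> bool" where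
  "optimal_matching A J K x c m \<longleftrightarrow>
     feasible_matching A J K x m \<and>
     (\<forall>m'. feasible_matching A J K x m' \<longrightarrow> social_cost A J K m c \<le> social_cost A J K m' c)"


section \<open>The mechanism\<close>

text \<open>The outcome of the mechanism depends on how ties between optimal matchings are broken;
  \<open>M\<close> maps each bid profile to the matching that the platform chooses. Such
  rules exist whenever \<open>x\<close> is a flow of \<open>card A\<close> units: it then decomposes into \<open>card A\<close> paths.\<close>

definition selection_rule ::
  "'a set \<Rightarrow> 'j set \<Rightarrow> nat \<Rightarrow> 'j flow \<Rightarrow> (('a, 'j) profile \<Rightarrow> ('a, 'j) matching) \<Rightarrow> bool" where
  "selection_rule A J K x M \<longleftrightarrow> (\<forall>b. optimal_matching A J K x b (M b))"

text \<open>If \<open>x\<close> is a flow of \<open>card A\<close> units, then the minimum below ranges over a finite nonempty set: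
  the matchings are binary, and \<open>x\<close> decomposes into \<open>card A\<close> paths. It does not depend on the bid
  of \<open>a\<close>.\<close>

definition min_cost_without ::
  "'a set \<Rightarrow> 'j set \<Rightarrow> nat \<Rightarrow> 'j flow \<Rightarrow> 'a \<Rightarrow> ('a, 'j) profile \<Rightarrow> real" where
  "min_cost_without A J K x a b =
     Min ((\<lambda>m. social_cost (A - {a}) J K m b) ` {m. feasible_without A J K x a m})"

definition reward ::
  "'a set \<Rightarrow> 'j set \<Rightarrow> nat \<Rightarrow> 'j flow \<Rightarrow> (('a, 'j) profile \<Rightarrow> ('a, 'j) matching) \<Rightarrow>
   'a \<Rightarrow> ('a, 'j) profile \<Rightarrow> real" where
  "reward A J K x M a b = min_cost_without A J K x a b - social_cost (A - {a}) J K (M b) b"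

text \<open>\<open>c\<close> are the true costs, \<open>b\<close> is the submitted bid profile.\<close>

definition utility ::
  "'a set \<Rightarrow> 'j set \<Rightarrow> nat \<Rightarrow> 'j flow \<Rightarrow> (('a, 'j) profile \<Rightarrow> ('a, 'j) matching) \<Rightarrow>
   ('a, 'j) profile \<Rightarrow> 'a \<Rightarrow> ('a, 'j) profile \<Rightarrow> real" where
  "utility A J K x M c a b = reward A J K x M a b - driver_cost J K (M b a) (c a)"

end

theory Submission
  imports Defs
begin

text \<open>The reward is a Groves payment: its first term is out of reach of the bid of driver \<open>a\<close>, and
  its second term passes on to \<open>a\<close> the cost that the others report. Adding the true cost of \<open>a\<close>
  to the latter, the utility of \<open>a\<close> is a constant minus the social cost of the chosen matching
  under the profile in which \<open>a\<close> is truthful (\<open>utility_eq_constant_minus_social_cost\<close>). The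
  platform minimizes exactly this social cost when \<open>a\<close> bids truthfully, whereas any other bid only
  makes it choose some other feasible matching. Efficiency is the optimality of the
  chosen matching at the profile of true costs.\<close>

lemma social_cost_without_upd:
  "social_cost (A - {a}) J K m (b(a := v)) = social_cost (A - {a}) J K m b"
  unfolding social_cost_def by (rule sum.cong) auto

lemma min_cost_without_upd:
  "min_cost_without A J K x a (b(a := v)) = min_cost_without A J K x a b"
  unfolding min_cost_without_def by (simp add: social_cost_without_upd)

lemma social_cost_split_driver:
  assumes "finite A" and "a \<in> A"
  shows "social_cost A J K m (b(a := v)) =
    driver_cost J K (m a) v + social_cost (A - {a}) J K m b"
proof -
  have "social_cost A J K m (b(a := v)) =
      driver_cost J K (m a) v + social_cost (A - {a}) J K m (b(a := v))"
    using assms unfolding social_cost_def by (simp add: sum.remove)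
  then show ?thesis by (simp add: social_cost_without_upd)
qed

text \<open>The bid enters the right-hand side only through the matching it leads to, so the incentive of
  \<open>a\<close> is that of a planner who knows the true cost of \<open>a\<close>.\<close>

lemma utility_eq_constant_minus_social_cost:
  assumes "finite A" and "a \<in> A"
  shows "utility A J K x M c a (b(a := bid)) =
    min_cost_without A J K x a b - social_cost A J K (M (b(a := bid))) (b(a := c a))"
  unfolding utility_def reward_def
  by (simp add: min_cost_without_upd social_cost_without_upd social_cost_split_driver[OF assms])

theorem proposition6p2:
  fixes A :: "'a set" and J :: "'j set" and K :: nat
    and x :: "'j flow"
    and c :: "('a, 'j) profile"
    and M :: "('a, 'j) profile \<Rightarrow> ('a, 'j) matching"
  assumes "finite A" and "finite J" and "K \<ge> 1"
    and "is_flow J K (card A) x"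
    and "selection_rule A J K x M"
  shows "(\<forall>a\<in>A. \<forall>bid :: 'j costs. \<forall>b :: ('a, 'j) profile.
            utility A J K x M c a (b(a := c a)) \<ge> utility A J K x M c a (b(a := bid)))
       \<and> optimal_matching A J K x c (M c)"
proof (intro conjI ballI allI)
  fix a bid and b :: "('a, 'j) profile"
  assume a: "a \<in> A"
  have opt: "optimal_matching A J K x b' (M b')" for b'
    using assms(5) by (simp add: selection_rule_def)
  have "social_cost A J K (M (b(a := c a))) (b(a := c a)) \<le>
      social_cost A J K (M (b(a := bid))) (b(a := c a))"
    using opt[of "b(a := c a)"] opt[of "b(a := bid)"] by (simp add: optimal_matching_def)
  then show "utility A J K x M c a (b(a := c a)) \<ge> utility A J K x M c a (b(a := bid))"
    by (simp add: utility_eq_constant_minus_social_cost[OF assms(1) a])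
next
  show "optimal_matching A J K x c (M c)"
    using assms(5) by (simp add: selection_rule_def)
qed

end
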